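(* Let $n\ge 1$ and let $\mathbb{M}$ be the set of monomials in $x_1,\dots,x_n$. Division I and Division II (defined in the context) are involutive divisions on $\mathbb{M}$.
   Context: $\mathbb{M}=\{x_1^{d_1}\cdots x_n^{d_n}\mid d_i\in\mathbb{N}\}$ with $\mathbb{N}$ the non-negative integers; $\deg_i(u)$ is the exponent of $x_i$ in $u$; $u\mid v$ is ordinary divisibility. Involutive division. An involutive division $L$ on $\mathbb{M}$ is given if for every finite set $U\subset\mathbb{M}$ and every $u\in U$ there is given a submonoid $L(u,U)$ of $\mathbb{M}$ such that: (a) if $w\in L(u,U)$ and $v\mid w$ then $v\in L(u,U)$; (b) if $u,v\in U$ and $uL(u,U)\cap vL(v,U)\ne\emptyset$ then $u\in vL(v,U)$ or $v\in uL(u,U)$; (c) if $v\in U$ and $v\in uL(u,U)$ then $L(v,U)\subseteq L(u,U)$; (d) if $V\subseteq U$ then $L(u,U)\subseteq L(u,V)$ for all $u\in V$. A division may be specified by giving, for each finite $U$ and $u\in U$, a partition of $\{x_1,\dots,x_n\}$ into multiplicative variables $M_L(u,U)$ and non-multiplicative variables $NM_L(u,U)$; then $L(u,U)$ is the submonoid of monomials in the variables of $M_L(u,U)$. Division I. For a finite set $U$, the variable $x_i$ is non-multiplicative for $u\in U$ if there are $v\in U$, an integer $m$ with $1\le m\le [n/2]$ (integer part), distinct variables $x_{i_1},\dots,x_{i_m}$ and exponents $d_1,\dots,d_m>0$ with $x_{i_1}^{d_1}\cdots x_{i_m}^{d_m}\,u=\mathrm{lcm}(u,v)$ and $x_i\in\{x_{i_1},\dots,x_{i_m}\}$;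 all other variables are multiplicative for $u$. Division II. For $u=x_1^{d_1}\cdots x_n^{d_n}$ (independently of $U$), the variable $x_i$ is multiplicative if $d_i=\max\{d_1,\dots,d_n\}$, and non-multiplicative otherwise. *)

theory Defs
  imports "HOL-Algebra.FiniteProduct" "HOL-Algebra.Divisibility"
begin

text \<open>The monomial \<open>x\<^sub>1^d\<^sub>1 \<cdots> x\<^sub>n^d\<^sub>n\<close> is its exponent function \<open>d\<close>, which is taken to vanish outside
  \<open>{1..n}\<close>; multiplication of monomials is addition of exponents.  Hence \<open>u i\<close> is the degree of
  \<open>u\<close> in the variable with index \<open>i\<close>, and sets of variables are sets of indices.\<close>

definition monomials :: "nat \<Rightarrow> (nat \<Rightarrow> nat) monoid" where
  "monomials n = \<lparr>carrier = {u. \<forall>i. i \<notin> {1..n} \<longrightarrow> u i = 0},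
                  monoid.mult = (\<lambda>u v i. u i + v i),
                  one = (\<lambda>i. 0)\<rparr>"

definition variable :: "nat \<Rightarrow> nat \<Rightarrow> nat" where
  "variable i = (\<lambda>j. if j = i then 1 else 0)"

text \<open>\<open>L U u\<close> is \<open>L(u,U)\<close>; its values for infinite \<open>U\<close> or for \<open>u \<notin> U\<close> are irrelevant.\<close>

definition involutive_division ::
    "nat \<Rightarrow> ((nat \<Rightarrow> nat) set \<Rightarrow> (nat \<Rightarrow> nat) \<Rightarrow> (nat \<Rightarrow> nat) set) \<Rightarrow> bool" where
  "involutive_division n L \<longleftrightarrow>
    (\<forall>U. finite U \<and> U \<subseteq> carrier (monomials n) \<longrightarrow>
      (\<forall>u\<in>U. submonoid (L U u) (monomials n)) \<and>
      (\<forall>u\<in>U. \<forall>w\<in>L U u. \<forall>v\<in>carrier (monomials n).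
         v divides\<^bsub>monomials n\<^esub> w \<longrightarrow> v \<in> L U u) \<and>
      (\<forall>u\<in>U. \<forall>v\<in>U.
         (u <#\<^bsub>monomials n\<^esub> L U u) \<inter> (v <#\<^bsub>monomials n\<^esub> L U v) \<noteq> {} \<longrightarrow>
         u \<in> v <#\<^bsub>monomials n\<^esub> L U v \<or> v \<in> u <#\<^bsub>monomials n\<^esub> L U u) \<and>
      (\<forall>u\<in>U. \<forall>v\<in>U. v \<in> u <#\<^bsub>monomials n\<^esub> L U u \<longrightarrow> L U v \<subseteq> L U u) \<and>
      (\<forall>V\<subseteq>U. \<forall>u\<in>V. L U u \<subseteq> L V u))"

definition monomials_in :: "nat \<Rightarrow> nat set \<Rightarrow> (nat \<Rightarrow> nat) set" where
  "monomials_in n S = {w \<in> carrier (monomials n). \<forall>i. w i > 0 \<longrightarrow> i \<in> S}"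

text \<open>Here \<open>J\<close> is \<open>{i\<^sub>1, \<dots>, i\<^sub>m}\<close> and \<open>m\<close> is its cardinality.  The least common multiple in
  \<open>monomials n\<close> is unique, since the only unit is the monomial 1, so \<open>lcmof\<close> expresses an equation.\<close>

definition nonmult_I :: "nat \<Rightarrow> (nat \<Rightarrow> nat) set \<Rightarrow> (nat \<Rightarrow> nat) \<Rightarrow> nat set" where
  "nonmult_I n U u =
    {i. \<exists>v\<in>U. \<exists>J d. J \<subseteq> {1..n} \<and> 1 \<le> card J \<and> card J \<le> n div 2 \<and> (\<forall>j\<in>J. d j > 0) \<and>
        ((\<Otimes>\<^bsub>monomials n\<^esub>j\<in>J. variable j [^]\<^bsub>monomials n\<^esub> (d j :: nat)) \<otimes>\<^bsub>monomials n\<^esub> u)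
          lcmof\<^bsub>monomials n\<^esub> u v \<and>
        i \<in> J}"

definition division_I ::
    "nat \<Rightarrow> (nat \<Rightarrow> nat) set \<Rightarrow> (nat \<Rightarrow> nat) \<Rightarrow> (nat \<Rightarrow> nat) set" where
  "division_I n U u = monomials_in n ({1..n} - nonmult_I n U u)"

definition mult_II :: "nat \<Rightarrow> (nat \<Rightarrow> nat) \<Rightarrow> nat set" where
  "mult_II n u = {i \<in> {1..n}. u i = Max (u ` {1..n})}"

definition division_II ::
    "nat \<Rightarrow> (nat \<Rightarrow> nat) set \<Rightarrow> (nat \<Rightarrow> nat) \<Rightarrow> (nat \<Rightarrow> nat) set" where
  "division_II n U u = monomials_in n (mult_II n u)"

end

theory Submission
  imports Defs
begin

text \<open>A monomial is its vector of exponents, so divisibility is the pointwise order, and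
  \<open>v \<in> u L(u,U)\<close> says that \<open>u \<le> v\<close> and that \<open>u\<close> and \<open>v\<close> differ only in multiplicative variables
  of \<open>u\<close>.  For a division given by multiplicative variables \<open>M U u\<close>, the submonoid axiom and axiom
  (a) are therefore automatic.  In axiom (b), if \<open>t\<close> is a common multiple of \<open>u\<close> and \<open>v\<close> in both
  cones and \<open>v \<le> u\<close>, then \<open>u\<close> lies between \<open>v\<close> and \<open>t\<close>, so \<open>u\<close> lies in the cone of \<open>v\<close>; hence (b)
  only asks that two elements with intersecting cones are comparable.  This is the criterion
  \<open>involutive_division_by_variables\<close>.

  For Division I, the lcm equation forces \<open>{i\<^sub>1, \<dots>, i\<^sub>m}\<close> to be the set \<open>J = {i. u i < v i}\<close>, so
  the non-multiplicative variables of \<open>u\<close> are the union of those of these sets that are nonempty and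
  of size at most \<open>n/2\<close> (\<open>nonmult_I_eq\<close>).  For incomparable \<open>u\<close> and \<open>v\<close>, the sets where \<open>u < v\<close> and
  where \<open>v < u\<close> are disjoint and nonempty, so one of them has at most \<open>n/2\<close> elements.  Say it is the
  first: it is non-multiplicative for \<open>u\<close>, while a common multiple of \<open>u\<close> and \<open>v\<close> has to exceed
  \<open>u\<close> there.  For (c), passing from \<open>u\<close> to \<open>v\<close> in its cone changes no
  exponent in the set \<open>J\<close> of any witness, and so \<open>J\<close> is also the set of that witness for \<open>v\<close>.

  For Division II, every \<open>t\<close> in the cone of \<open>u\<close> determines \<open>u\<close> as the truncation of \<open>t\<close> at the
  maximal exponent of \<open>u\<close> (\<open>truncation_at_max_degree\<close>), and two truncations of the same \<open>t\<close> are
  comparable.  For (c), if \<open>v\<close> lies in the cone of \<open>u\<close>, then a variable of maximal exponent in \<open>v\<close>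
  has either gained from \<open>u\<close> to \<open>v\<close>, and so is multiplicative for \<open>u\<close>, or kept its exponent,
  which bounds all exponents of \<open>v\<close> and hence those of \<open>u\<close>.\<close>

section \<open>Monomials as exponent vectors\<close>

lemma carrier_monomials_iff: "u \<in> carrier (monomials n) \<longleftrightarrow> (\<forall>i. i \<notin> {1..n} \<longrightarrow> u i = 0)"
  by (simp add: monomials_def)

lemma mult_monomials: "u \<otimes>\<^bsub>monomials n\<^esub> v = (\<lambda>i. u i + v i)"
  by (simp add: monomials_def)

lemma one_monomials: "\<one>\<^bsub>monomials n\<^esub> = (\<lambda>i. 0)"
  by (simp add: monomials_def)

lemma comm_monoid_monomials: "comm_monoid (monomials n)"
  by (rule comm_monoidI) (auto simp: monomials_def add_ac)

lemma degree_less_in_range: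
  assumes "v \<in> carrier (monomials n)"
  shows "{i. u i < v i} \<subseteq> {1..n}"
proof
  fix i assume "i \<in> {i. u i < v i}"
  then have "v i \<noteq> 0" by simp
  then show "i \<in> {1..n}"
    using assms by (auto simp: carrier_monomials_iff)
qed

lemma divides_monomials_iff:
  assumes "u \<in> carrier (monomials n)" "v \<in> carrier (monomials n)"
  shows "u divides\<^bsub>monomials n\<^esub> v \<longleftrightarrow> u \<le> v"
proof
  assume "u divides\<^bsub>monomials n\<^esub> v"
  then show "u \<le> v"
    by (auto simp: factor_def mult_monomials le_fun_def)
next
  assume "u \<le> v"
  then have "v = u \<otimes>\<^bsub>monomials n\<^esub> (\<lambda>i. v i - u i)"
    by (auto simp: mult_monomials le_fun_def)
  moreover have "(\<lambda>i. v i - u i) \<in> carrier (monomials n)"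
    using assms by (simp add: carrier_monomials_iff)
  ultimately show "u divides\<^bsub>monomials n\<^esub> v"
    unfolding factor_def by blast
qed

lemma mem_cone_iff:
  assumes "u \<in> carrier (monomials n)"
  shows "v \<in> u <#\<^bsub>monomials n\<^esub> monomials_in n S \<longleftrightarrow>
    v \<in> carrier (monomials n) \<and> u \<le> v \<and> {i. u i < v i} \<subseteq> S"
proof
  assume "v \<in> u <#\<^bsub>monomials n\<^esub> monomials_in n S"
  then show "v \<in> carrier (monomials n) \<and> u \<le> v \<and> {i. u i < v i} \<subseteq> S"
    using assms
    by (auto simp: l_coset_def monomials_in_def mult_monomials carrier_monomials_iff le_fun_def)
next
  assume v: "v \<in> carrier (monomials n) \<and> u \<le> v \<and> {i. u i < v i} \<subseteq> S"
  then have "v = u \<otimes>\<^bsub>monomials n\<^esub> (\<lambda>i. v i - u i)"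
    by (auto simp: mult_monomials le_fun_def)
  moreover have "(\<lambda>i. v i - u i) \<in> monomials_in n S"
    using assms v by (auto simp: monomials_in_def carrier_monomials_iff)
  ultimately show "v \<in> u <#\<^bsub>monomials n\<^esub> monomials_in n S"
    unfolding l_coset_def by blast
qed

lemma submonoid_monomials_in: "submonoid (monomials_in n S) (monomials n)"
  by (rule submonoid.intro)
    (auto simp: monomials_in_def carrier_monomials_iff mult_monomials one_monomials)

section \<open>Divisions given by multiplicative variables\<close>

text \<open>Comparability suffices for axiom (b) because cones are convex: if \<open>v \<le> u \<le> t\<close> and \<open>t\<close> is in
  the cone of \<open>v\<close>, then so is \<open>u\<close>.\<close>

lemma involutive_division_by_variables:
  assumes comparable: "\<And>U u v t. \<lbrakk>finite U; U \<subseteq> carrier (monomials n); u \<in> U; v \<in> U;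
      t \<in> carrier (monomials n); u \<le> t; {i. u i < t i} \<subseteq> M U u;
      v \<le> t; {i. v i < t i} \<subseteq> M U v\<rbrakk> \<Longrightarrow> u \<le> v \<or> v \<le> u"
    and shrinking: "\<And>U u v. \<lbrakk>finite U; U \<subseteq> carrier (monomials n); u \<in> U; v \<in> U;
      u \<le> v; {i. u i < v i} \<subseteq> M U u\<rbrakk> \<Longrightarrow> M U v \<subseteq> M U u"
    and antimono: "\<And>U V u. \<lbrakk>finite U; U \<subseteq> carrier (monomials n); V \<subseteq> U; u \<in> V\<rbrakk>
      \<Longrightarrow> M U u \<subseteq> M V u"
  shows "involutive_division n (\<lambda>U u. monomials_in n (M U u))"
  unfolding involutive_division_def
proof (intro allI impI conjI ballI)
  fix U u
  show "submonoid (monomials_in n (M U u)) (monomials n)"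
    by (rule submonoid_monomials_in)
next
  fix U u w v
  assume w: "w \<in> monomials_in n (M U u)" and v: "v \<in> carrier (monomials n)"
    and dvd: "v divides\<^bsub>monomials n\<^esub> w"
  then have "v \<le> w"
    using divides_monomials_iff by (auto simp: monomials_in_def)
  then have "w i > 0" if "v i > 0" for i
    using that by (metis le_funD less_le_trans)
  then show "v \<in> monomials_in n (M U u)"
    using w v by (auto simp: monomials_in_def)
next
  fix U u v
  assume U: "finite U \<and> U \<subseteq> carrier (monomials n)" and u: "u \<in> U" and v: "v \<in> U"
  have uv: "u \<in> carrier (monomials n)" "v \<in> carrier (monomials n)"
    using U u v by auto
  assume "(u <#\<^bsub>monomials n\<^esub> monomials_in n (M U u)) \<inter>
    (v <#\<^bsub>monomials n\<^esub> monomials_in n (M U v)) \<noteq> {}"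
  then obtain t where t: "t \<in> carrier (monomials n)" "u \<le> t" "{i. u i < t i} \<subseteq> M U u"
      "v \<le> t" "{i. v i < t i} \<subseteq> M U v"
    using uv by (auto simp: mem_cone_iff)
  have "{i. u i < v i} \<subseteq> {i. u i < t i}" "{i. v i < u i} \<subseteq> {i. v i < t i}"
    using t(2,4) by (auto simp: le_fun_def intro: less_le_trans)
  then have "{i. u i < v i} \<subseteq> M U u" "{i. v i < u i} \<subseteq> M U v"
    using t by auto
  moreover have "u \<le> v \<or> v \<le> u"
    using comparable U u v t by blast
  ultimately show "u \<in> v <#\<^bsub>monomials n\<^esub> monomials_in n (M U v) \<or>
      v \<in> u <#\<^bsub>monomials n\<^esub> monomials_in n (M U u)"
    using uv by (auto simp: mem_cone_iff)
next
  fix U u v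
  assume U: "finite U \<and> U \<subseteq> carrier (monomials n)" and u: "u \<in> U" and v: "v \<in> U"
    and "v \<in> u <#\<^bsub>monomials n\<^esub> monomials_in n (M U u)"
  then have "u \<le> v" "{i. u i < v i} \<subseteq> M U u"
    using mem_cone_iff[of u n v "M U u"] by auto
  then have "M U v \<subseteq> M U u"
    using shrinking U u v by blast
  then show "monomials_in n (M U v) \<subseteq> monomials_in n (M U u)"
    by (auto simp: monomials_in_def)
next
  fix U V u
  assume "finite U \<and> U \<subseteq> carrier (monomials n)" "V \<subseteq> U" "u \<in> V"
  then have "M U u \<subseteq> M V u"
    using antimono by blast
  then show "monomials_in n (M U u) \<subseteq> monomials_in n (M V u)"
    by (auto simp: monomials_in_def)
qed

section \<open>Division I\<close>

lemma variable_pow: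
  "variable j [^]\<^bsub>monomials n\<^esub> (k :: nat) = (\<lambda>i. if i = j then k else 0)"
  by (induction k) (auto simp: one_monomials mult_monomials variable_def)

lemma finprod_variable_pow:
  assumes "J \<subseteq> {1..n}"
  shows "(\<Otimes>\<^bsub>monomials n\<^esub>j\<in>J. variable j [^]\<^bsub>monomials n\<^esub> (d j :: nat)) =
    (\<lambda>i. if i \<in> J then d i else 0)"
proof -
  interpret comm_monoid "monomials n"
    by (rule comm_monoid_monomials)
  have "finite J"
    using assms finite_subset by blast
  then show ?thesis
    using assms
  proof (induction J rule: finite_induct)
    case empty
    then show ?case by (simp add: one_monomials)
  next
    case (insert j J)
    have "(\<lambda>j. variable j [^]\<^bsub>monomials n\<^esub> (d j)) \<in> J \<rightarrow> carrier (monomials n)"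
      using insert.prems by (auto simp: variable_pow carrier_monomials_iff)
    moreover have "variable j [^]\<^bsub>monomials n\<^esub> (d j) \<in> carrier (monomials n)"
      using insert.prems by (auto simp: variable_pow carrier_monomials_iff)
    ultimately show ?case
      using insert by (auto simp: finprod_insert mult_monomials variable_pow)
  qed
qed

lemma lcmof_monomials_iff:
  assumes "x \<in> carrier (monomials n)" "u \<in> carrier (monomials n)" "v \<in> carrier (monomials n)"
  shows "x lcmof\<^bsub>monomials n\<^esub> u v \<longleftrightarrow> x = sup u v"
proof -
  have "sup u v \<in> carrier (monomials n)"
    using assms by (simp add: carrier_monomials_iff)
  then show ?thesis
    using assms by (auto simp: islcm_def divides_monomials_iff intro: antisym)
qed

lemma lcmof_cofactor_iff:
  assumes u: "u \<in> carrier (monomials n)" and v: "v \<in> carrier (monomials n)"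
    and J: "J \<subseteq> {1..n}" and d: "\<forall>j\<in>J. d j > 0"
  shows "((\<Otimes>\<^bsub>monomials n\<^esub>j\<in>J. variable j [^]\<^bsub>monomials n\<^esub> (d j :: nat)) \<otimes>\<^bsub>monomials n\<^esub> u)
      lcmof\<^bsub>monomials n\<^esub> u v \<longleftrightarrow> J = {i. u i < v i} \<and> (\<forall>j\<in>J. d j = v j - u j)"
    (is "?x lcmof\<^bsub>_\<^esub> u v \<longleftrightarrow> ?R")
proof -
  have x: "?x = (\<lambda>i. (if i \<in> J then d i else 0) + u i)"
    by (simp add: finprod_variable_pow[OF J] mult_monomials)
  have "?x \<in> carrier (monomials n)"
    using u J unfolding x by (auto simp: carrier_monomials_iff)
  then have "?x lcmof\<^bsub>monomials n\<^esub> u v \<longleftrightarrow> ?x = sup u v"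
    using u v by (rule lcmof_monomials_iff)
  also have "\<dots> \<longleftrightarrow> (\<forall>i. (if i \<in> J then d i else 0) + u i = max (u i) (v i))"
    by (simp add: x fun_eq_iff sup_max)
  also have "\<dots> \<longleftrightarrow> (\<forall>i. (i \<in> J \<longleftrightarrow> u i < v i) \<and> (i \<in> J \<longrightarrow> d i = v i - u i))"
  proof (rule all_cong1)
    fix i
    show "(if i \<in> J then d i else 0) + u i = max (u i) (v i) \<longleftrightarrow>
        (i \<in> J \<longleftrightarrow> u i < v i) \<and> (i \<in> J \<longrightarrow> d i = v i - u i)"
      using d by (cases "i \<in> J") (auto simp: max_def)
  qed
  also have "\<dots> \<longleftrightarrow> ?R"
    by auto
  finally show ?thesis .
qed

lemma nonmult_I_eq:
  assumes u: "u \<in> carrier (monomials n)" and U: "U \<subseteq> carrier (monomials n)"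
  shows "nonmult_I n U u =
    {i. \<exists>v\<in>U. u i < v i \<and> card {j. u j < v j} \<le> n div 2}"
proof (intro equalityI subsetI)
  fix i assume "i \<in> nonmult_I n U u"
  then show "i \<in> {i. \<exists>v\<in>U. u i < v i \<and> card {j. u j < v j} \<le> n div 2}"
    using u U lcmof_cofactor_iff unfolding nonmult_I_def by blast
next
  fix i assume "i \<in> {i. \<exists>v\<in>U. u i < v i \<and> card {j. u j < v j} \<le> n div 2}"
  then obtain v where v: "v \<in> U" "u i < v i" "card {j. u j < v j} \<le> n div 2"
    by blast
  define J where "J = {j. u j < v j}"
  define d where "d j = v j - u j" for j
  have J: "J \<subseteq> {1..n}"
    using degree_less_in_range v(1) U unfolding J_def by blast
  have "i \<in> J"
    using v(2) by (simp add: J_def)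
  then have "1 \<le> card J"
    using J finite_subset[OF J] by (auto simp: Suc_le_eq card_gt_0_iff)
  moreover have "\<forall>j\<in>J. d j > 0"
    by (simp add: J_def d_def)
  moreover from this have
    "((\<Otimes>\<^bsub>monomials n\<^esub>j\<in>J. variable j [^]\<^bsub>monomials n\<^esub> (d j :: nat)) \<otimes>\<^bsub>monomials n\<^esub> u)
      lcmof\<^bsub>monomials n\<^esub> u v"
    using lcmof_cofactor_iff[OF u _ J] v(1) U by (auto simp: J_def d_def)
  ultimately show "i \<in> nonmult_I n U u"
    using J v \<open>i \<in> J\<close> unfolding nonmult_I_def J_def by blast
qed

text \<open>The bound \<open>n/2\<close> enters here: two disjoint sets of variables cannot both have more than \<open>n/2\<close>
  elements.\<close>

lemma card_less_or_greater_le_half: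
  assumes "u \<in> carrier (monomials n)" "v \<in> carrier (monomials n)"
  shows "card {i. u i < v i} \<le> n div 2 \<or> card {i. v i < u i} \<le> n div 2"
proof -
  have sub: "{i. u i < v i} \<subseteq> {1..n}" "{i. v i < u i} \<subseteq> {1..n}"
    using assms degree_less_in_range by blast+
  have "card {i. u i < v i} + card {i. v i < u i} = card ({i. u i < v i} \<union> {i. v i < u i})"
    using sub finite_subset by (intro card_Un_disjoint[symmetric]) auto
  also have "\<dots> \<le> n"
    using sub card_mono[of "{1..n}" "{i. u i < v i} \<union> {i. v i < u i}"] by auto
  finally show ?thesis by linarith
qed

text \<open>A common multiple exceeds \<open>u\<close> wherever \<open>v\<close> does, which is impossible in non-multiplicative
  variables of \<open>u\<close>.\<close>

lemma le_if_few_degrees_less: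
  assumes "u \<in> carrier (monomials n)" "U \<subseteq> carrier (monomials n)" "v \<in> U"
    and half: "card {i. u i < v i} \<le> n div 2"
    and "v \<le> t" and mult: "{i. u i < t i} \<subseteq> {1..n} - nonmult_I n U u"
  shows "v \<le> u"
proof (rule ccontr)
  assume "\<not> v \<le> u"
  then obtain i where i: "u i < v i"
    by (auto simp: le_fun_def not_le)
  then have "i \<in> nonmult_I n U u"
    using assms by (auto simp: nonmult_I_eq)
  moreover have "u i < t i"
    using i \<open>v \<le> t\<close> by (metis le_funD less_le_trans)
  ultimately show False
    using mult by blast
qed

lemma involutive_division_I: "involutive_division n (division_I n)"
proof -
  have "involutive_division n (\<lambda>U u. monomials_in n ({1..n} - nonmult_I n U u))"
  proof (rule involutive_division_by_variables)
    fix U u v t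
    assume "U \<subseteq> carrier (monomials n)" "u \<in> U" "v \<in> U" "u \<le> t" "v \<le> t"
      "{i. u i < t i} \<subseteq> {1..n} - nonmult_I n U u" "{i. v i < t i} \<subseteq> {1..n} - nonmult_I n U v"
    then show "u \<le> v \<or> v \<le> u"
      using card_less_or_greater_le_half[of u n v] le_if_few_degrees_less by blast
  next
    fix U u v
    assume U: "U \<subseteq> carrier (monomials n)" and u: "u \<in> U" and v: "v \<in> U" and "u \<le> v"
      and mult: "{i. u i < v i} \<subseteq> {1..n} - nonmult_I n U u"
    have "nonmult_I n U u \<subseteq> nonmult_I n U v"
    proof
      fix i assume "i \<in> nonmult_I n U u"
      then obtain z where z: "z \<in> U" "u i < z i" "card {j. u j < z j} \<le> n div 2"
        using nonmult_I_eq U u by blast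
      have "{j. u j < z j} = {j. v j < z j}"
      proof (intro equalityI subsetI; simp)
        fix j assume "v j < z j"
        then show "u j < z j"
          using \<open>u \<le> v\<close> by (metis le_funD le_less_trans)
      next
        fix j assume j: "u j < z j"
        then have "j \<in> nonmult_I n U u"
          using nonmult_I_eq U u z by blast
        then have "\<not> u j < v j"
          using mult by blast
        then show "v j < z j"
          using j by linarith
      qed
      then show "i \<in> nonmult_I n U v"
        using nonmult_I_eq[of v n U] U v z by auto
    qed
    then show "{1..n} - nonmult_I n U v \<subseteq> {1..n} - nonmult_I n U u"
      by blast
  next
    fix U V :: "(nat \<Rightarrow> nat) set" and u
    assume "V \<subseteq> U"
    then have "nonmult_I n V u \<subseteq> nonmult_I n U u"
      unfolding nonmult_I_def by blast
    then show "{1..n} - nonmult_I n U u \<subseteq> {1..n} - nonmult_I n V u"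
      by blast
  qed
  then show ?thesis
    by (simp add: division_I_def[abs_def])
qed

section \<open>Division II\<close>

lemma degree_le_Max:
  fixes u :: "nat \<Rightarrow> nat"
  assumes "i \<in> {1..n}"
  shows "u i \<le> Max (u ` {1..n})"
  using assms by (intro Max_ge) auto

text \<open>A multiple of \<open>u\<close> in its cone differs from \<open>u\<close> only where \<open>u\<close> is maximal.\<close>

lemma truncation_at_max_degree:
  fixes u t :: "nat \<Rightarrow> nat"
  assumes "u \<le> t" "{i. u i < t i} \<subseteq> mult_II n u" "i \<in> {1..n}"
  shows "u i = min (t i) (Max (u ` {1..n}))"
proof (cases "u i < t i")
  case True
  then have "u i = Max (u ` {1..n})"
    using assms(2) by (auto simp: mult_II_def)
  then show ?thesis
    using True by simp
next
  case False
  then have "u i = t i"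
    using assms(1) by (simp add: le_fun_def le_antisym)
  then show ?thesis
    using degree_le_Max[OF assms(3), of u] by simp
qed

lemma involutive_division_II: "involutive_division n (division_II n)"
proof -
  have "involutive_division n (\<lambda>U u. monomials_in n (mult_II n u))"
  proof (rule involutive_division_by_variables)
    fix U u v t
    assume "U \<subseteq> carrier (monomials n)" and uv: "u \<in> U" "v \<in> U"
      and t: "u \<le> t" "v \<le> t" "{i. u i < t i} \<subseteq> mult_II n u" "{i. v i < t i} \<subseteq> mult_II n v"
    then have outside: "u i = 0" "v i = 0" if "i \<notin> {1..n}" for i
      using that carrier_monomials_iff by blast+
    have inside: "u i = min (t i) (Max (u ` {1..n}))" "v i = min (t i) (Max (v ` {1..n}))"
      if "i \<in> {1..n}" for i
      using t that truncation_at_max_degree by blast+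
    consider "Max (u ` {1..n}) \<le> Max (v ` {1..n})" | "Max (v ` {1..n}) \<le> Max (u ` {1..n})"
      by linarith
    then show "u \<le> v \<or> v \<le> u"
    proof cases
      case 1
      have "u i \<le> v i" for i
        using 1 outside[of i] inside[of i] by (cases "i \<in> {1..n}") linarith+
      then show ?thesis by (simp add: le_fun_def)
    next
      case 2
      have "v i \<le> u i" for i
        using 2 outside[of i] inside[of i] by (cases "i \<in> {1..n}") linarith+
      then show ?thesis by (simp add: le_fun_def)
    qed
  next
    fix U :: "(nat \<Rightarrow> nat) set" and u v :: "nat \<Rightarrow> nat"
    assume "u \<le> v" and mult: "{i. u i < v i} \<subseteq> mult_II n u"
    show "mult_II n v \<subseteq> mult_II n u"
    proof
      fix i assume "i \<in> mult_II n v"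
      then have i: "i \<in> {1..n}" "v i = Max (v ` {1..n})"
        by (auto simp: mult_II_def)
      show "i \<in> mult_II n u"
      proof (cases "u i < v i")
        case True
        then show ?thesis using mult by blast
      next
        case False
        have "u j \<le> u i" if "j \<in> {1..n}" for j
        proof -
          have "u j \<le> v j"
            using \<open>u \<le> v\<close> by (simp add: le_fun_def)
          also have "\<dots> \<le> v i"
            using degree_le_Max[OF that, of v] i by simp
          also have "\<dots> \<le> u i"
            using False by simp
          finally show ?thesis .
        qed
        then have "Max (u ` {1..n}) = u i"
          using i(1) by (intro Max_eqI) auto
        then show ?thesis
          using i(1) by (simp add: mult_II_def)
      qed
    qed
  qed simp
  then show ?thesis
    by (simp add: division_II_def[abs_def])
qed

theorem proposition3p6:
  fixes n :: nat
  assumes "n \<ge> 1"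
  shows "involutive_division n (division_I n) \<and> involutive_division n (division_II n)"
  using involutive_division_I involutive_division_II by blast

end
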